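(* For any skew brace $A$ and any integer $t\ge1$, $A_{(t)}=1$ if and only if $\Gamma_{t+1}(A)=1$.
   Context: A skew (left) brace is a set $A$ with two group structures $(A,\cdot)$, $(A,\circ)$ such that $a\circ(b\cdot c)=(a\circ b)\cdot a^{-1}\cdot(a\circ c)$ for all $a,b,c$, where $a^{-1}$ is the inverse in $(A,\cdot)$. The two identities coincide, denoted $1$ (also the trivial subset). Put $\lambda_a(b)=a^{-1}\cdot(a\circ b)$, $a*b=\lambda_a(b)\cdot b^{-1}$, $[a,b]^{\cdot}=a\cdot b\cdot a^{-1}\cdot b^{-1}$. Lower central series: $\Gamma_1(A)=A$, and $\Gamma_n(A)$ is the subgroup of $(A,\cdot)$ generated by all $a*u$, $u*a$, $[a,u]^{\cdot}$ with $a\in A$, $u\in\Gamma_{n-1}(A)$. Commutator words: $M$ is the free monoid on the four symbols $X=\{\gamma,\bar\gamma,*,\bar *\}$, where $\gamma(a,b)=[a,b]^{\cdot}$, $\bar\gamma(a,b)=[b,a]^{\cdot}$, $*(a,b)=a*b$, $\bar *(a,b)=b*a$. For $m=\epsilon_1\cdots\epsilon_s\in M$ ($\epsilon_i\in X$), $\deg(m)=s$ and $m(a_1a_2\cdots a_{s+1})=\epsilon_1(a_1,\epsilon_2(a_2,\ldots,\epsilon_s(a_s,a_{s+1})\cdots))$. $A_{(t)}$ is the subgroup of $(A,\cdot)$ generated by all values $m(a_1\cdots a_{\deg(m)+1})$ with $m\in M$, $\deg(m)\ge t$, $a_i\in A$. *)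

theory Defs
  imports "HOL-Algebra.Generated_Groups"
begin

text \<open>A skew left brace is a set with two group structures. Here \<open>G\<close> is \<open>(A, \<cdot>)\<close> and \<open>H\<close> is
  \<open>(A, \<circ>)\<close>, two group records with the same carrier.\<close>

locale skew_brace = add: group G + circ: group H
  for G :: "('a, 'm) monoid_scheme" and H :: "('a, 'n) monoid_scheme" +
  assumes carrier_eq: "carrier H = carrier G"
    and brace_compat: "\<lbrakk>a \<in> carrier G; b \<in> carrier G; c \<in> carrier G\<rbrakk> \<Longrightarrow>
      a \<otimes>\<^bsub>H\<^esub> (b \<otimes>\<^bsub>G\<^esub> c) = (a \<otimes>\<^bsub>H\<^esub> b) \<otimes>\<^bsub>G\<^esub> inv\<^bsub>G\<^esub> a \<otimes>\<^bsub>G\<^esub> (a \<otimes>\<^bsub>H\<^esub> c)"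

lemma (in skew_brace) one_eq: "\<one>\<^bsub>H\<^esub> = \<one>\<^bsub>G\<^esub>"
proof -
  have e: "\<one>\<^bsub>H\<^esub> \<in> carrier G"
    using circ.one_closed by (simp add: carrier_eq)
  have l: "\<one>\<^bsub>H\<^esub> \<otimes>\<^bsub>H\<^esub> \<one>\<^bsub>G\<^esub> = \<one>\<^bsub>G\<^esub>"
    by (rule circ.l_one) (simp add: carrier_eq)
  have "\<one>\<^bsub>G\<^esub> = inv\<^bsub>G\<^esub> \<one>\<^bsub>H\<^esub>"
    using brace_compat[OF e add.one_closed add.one_closed] e l by simp
  then show ?thesis
    by (metis add.inv_inv add.inv_one e)
qed

definition brace_lambda ::
  "('a, 'm) monoid_scheme \<Rightarrow> ('a, 'n) monoid_scheme \<Rightarrow> 'a \<Rightarrow> 'a \<Rightarrow> 'a" where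
  "brace_lambda G H a b = inv\<^bsub>G\<^esub> a \<otimes>\<^bsub>G\<^esub> (a \<otimes>\<^bsub>H\<^esub> b)"

definition brace_star ::
  "('a, 'm) monoid_scheme \<Rightarrow> ('a, 'n) monoid_scheme \<Rightarrow> 'a \<Rightarrow> 'a \<Rightarrow> 'a" where
  "brace_star G H a b = brace_lambda G H a b \<otimes>\<^bsub>G\<^esub> inv\<^bsub>G\<^esub> b"

definition add_commutator :: "('a, 'm) monoid_scheme \<Rightarrow> 'a \<Rightarrow> 'a \<Rightarrow> 'a" where
  "add_commutator G a b = a \<otimes>\<^bsub>G\<^esub> b \<otimes>\<^bsub>G\<^esub> inv\<^bsub>G\<^esub> a \<otimes>\<^bsub>G\<^esub> inv\<^bsub>G\<^esub> b"

text \<open>The series \<open>\<Gamma>\<^sub>n(A)\<close> starts at \<open>n = 1\<close>; the value at \<open>0\<close> is a dummy.\<close>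

fun brace_Gamma ::
  "('a, 'm) monoid_scheme \<Rightarrow> ('a, 'n) monoid_scheme \<Rightarrow> nat \<Rightarrow> 'a set" where
  "brace_Gamma G H 0 = carrier G"
| "brace_Gamma G H (Suc 0) = carrier G"
| "brace_Gamma G H (Suc (Suc n)) = generate G
     (\<Union>a \<in> carrier G. \<Union>u \<in> brace_Gamma G H (Suc n).
       {brace_star G H a u, brace_star G H u a, add_commutator G a u})"

text \<open>The four symbols are \<open>\<gamma>\<close>, \<open>\<gamma>\<close> with a bar, \<open>*\<close> and \<open>*\<close> with a bar, where a bar swaps the
  arguments. The free monoid on them is the type of lists, with \<open>length\<close> as degree.\<close>

datatype comm_symbol = Comm | CommBar | Star | StarBar

primrec symbol_op ::
  "('a, 'm) monoid_scheme \<Rightarrow> ('a, 'n) monoid_scheme \<Rightarrow> comm_symbol \<Rightarrow> 'a \<Rightarrow> 'a \<Rightarrow> 'a" where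
  "symbol_op G H Comm a b = add_commutator G a b"
| "symbol_op G H CommBar a b = add_commutator G b a"
| "symbol_op G H Star a b = brace_star G H a b"
| "symbol_op G H StarBar a b = brace_star G H b a"

text \<open>Only meaningful when the list of arguments is one longer than the word, as required in
  \<open>brace_word_subgroup\<close>.\<close>

primrec word_value ::
  "('a, 'm) monoid_scheme \<Rightarrow> ('a, 'n) monoid_scheme \<Rightarrow> comm_symbol list \<Rightarrow> 'a list \<Rightarrow> 'a" where
  "word_value G H [] as = hd as"
| "word_value G H (e # m) as = symbol_op G H e (hd as) (word_value G H m (tl as))"

text \<open>The subgroup \<open>A\<^bsub>(t)\<^esub>\<close>.\<close>

definition brace_word_subgroup ::
  "('a, 'm) monoid_scheme \<Rightarrow> ('a, 'n) monoid_scheme \<Rightarrow> nat \<Rightarrow> 'a set" where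
  "brace_word_subgroup G H t = generate G
     {word_value G H m as | m as.
        length m \<ge> t \<and> length as = length m + 1 \<and> set as \<subseteq> carrier G}"

end

theory Submission
  imports Defs
begin

text \<open>
  The words of degree at least \<open>t\<close> all lie in \<open>\<Gamma>\<^bsub>t+1\<^esub>(A)\<close>, so one implication is immediate. The
  other one is not obvious, because \<open>\<Gamma>\<^bsub>t+1\<^esub>(A)\<close> is built from symbols applied to \<^emph>\<open>products\<close> of
  values of symbols, and these operations do not distribute over products. The way around this is to
  compare both series with the upper central (annihilator) series
  \<open>1 = Z\<^sub>0 \<subseteq> Z\<^sub>1 \<subseteq> \<dots>\<close>, in which \<open>Z\<^bsub>k+1\<^esub>\<close> consists of those \<open>z\<close> for which \<open>a * z\<close>, \<open>z * a\<close> and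
  \<open>[a, z]\<close> lie in \<open>Z\<^sub>k\<close> for every \<open>a\<close>.

  If \<open>A\<^bsub>(t)\<^esub> = 1\<close>, then words of degree at least \<open>t\<close> lie in \<open>Z\<^sub>0\<close>, hence those of degree at least
  \<open>t - 1\<close> lie in \<open>Z\<^sub>1\<close>, and so on, down to degree \<open>0\<close>: every element of \<open>A\<close> lies in \<open>Z\<^sub>t\<close>
  (\<open>carrier_subset_upper_central\<close>). From \<open>\<Gamma>\<^sub>1(A) = A = Z\<^sub>t\<close> one climbs back: \<open>\<Gamma>\<^bsub>k+1\<^esub>(A) \<subseteq> Z\<^bsub>t-k\<^esub>\<close>
  (\<open>Gamma_subset_upper_central\<close>), and \<open>k = t\<close> gives \<open>\<Gamma>\<^bsub>t+1\<^esub>(A) = 1\<close>. This second half needs that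
  each \<open>Z\<^sub>k\<close> is a subgroup of \<open>(A, \<cdot>)\<close>, and that is where the work lies: modulo \<open>Z\<^sub>k\<close> the
  set \<open>Z\<^bsub>k+1\<^esub>\<close> is the annihilator of a skew brace, on which both operations agree and commute with
  everything. Instead of forming quotient braces, the proof carries along the congruences whose
  classes of \<open>1\<close> are the \<open>Z\<^sub>k\<close>; the crucial fact is \<open>brace_congruence_annihilator_rel\<close>.
\<close>

section \<open>Congruences of skew braces\<close>

context skew_brace
begin

abbreviation add_op (infixl "\<cdot>" 70) where "a \<cdot> b \<equiv> a \<otimes>\<^bsub>G\<^esub> b"
abbreviation circ_op (infixl "\<odot>" 70) where "a \<odot> b \<equiv> a \<otimes>\<^bsub>H\<^esub> b"
abbreviation add_inv ("\<^bold>- _" [81] 80) where "\<^bold>- a \<equiv> inv\<^bsub>G\<^esub> a"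
abbreviation A where "A \<equiv> carrier G"

lemma circ_closed [simp]: "\<lbrakk>a \<in> A; b \<in> A\<rbrakk> \<Longrightarrow> a \<odot> b \<in> A"
  using circ.m_closed carrier_eq by simp

lemma circ_assoc: "\<lbrakk>a \<in> A; b \<in> A; c \<in> A\<rbrakk> \<Longrightarrow> (a \<odot> b) \<odot> c = a \<odot> (b \<odot> c)"
  using circ.m_assoc carrier_eq by simp

lemma circ_one [simp]:
  assumes "a \<in> A"
  shows "a \<odot> \<one>\<^bsub>G\<^esub> = a" "\<one>\<^bsub>G\<^esub> \<odot> a = a"
  using circ.r_one[of a] circ.l_one[of a] assms by (simp_all add: carrier_eq one_eq)

lemma symbol_op_closed [simp]: "\<lbrakk>a \<in> A; b \<in> A\<rbrakk> \<Longrightarrow> symbol_op G H e a b \<in> A"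
  by (cases e) (simp_all add: add_commutator_def brace_star_def brace_lambda_def)

end

locale brace_congruence = skew_brace +
  fixes R :: "'a \<Rightarrow> 'a \<Rightarrow> bool" (infix "\<sim>" 50)
  assumes in_carrier: "x \<sim> y \<Longrightarrow> x \<in> A \<and> y \<in> A"
    and cong_refl: "x \<in> A \<Longrightarrow> x \<sim> x"
    and cong_sym: "x \<sim> y \<Longrightarrow> y \<sim> x"
    and cong_trans [trans]: "\<lbrakk>x \<sim> y; y \<sim> z\<rbrakk> \<Longrightarrow> x \<sim> z"
    and add_cong: "\<lbrakk>x \<sim> y; x' \<sim> y'\<rbrakk> \<Longrightarrow> x \<cdot> x' \<sim> y \<cdot> y'"
    and circ_cong: "\<lbrakk>x \<sim> y; x' \<sim> y'\<rbrakk> \<Longrightarrow> x \<odot> x' \<sim> y \<odot> y'"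
begin

lemma add_cong_left: "\<lbrakk>x \<sim> y; a \<in> A\<rbrakk> \<Longrightarrow> a \<cdot> x \<sim> a \<cdot> y"
  by (simp add: add_cong cong_refl)

lemma add_cong_right: "\<lbrakk>x \<sim> y; a \<in> A\<rbrakk> \<Longrightarrow> x \<cdot> a \<sim> y \<cdot> a"
  by (simp add: add_cong cong_refl)

lemma circ_cong_left: "\<lbrakk>x \<sim> y; a \<in> A\<rbrakk> \<Longrightarrow> a \<odot> x \<sim> a \<odot> y"
  by (simp add: circ_cong cong_refl)

lemma circ_cong_right: "\<lbrakk>x \<sim> y; a \<in> A\<rbrakk> \<Longrightarrow> x \<odot> a \<sim> y \<odot> a"
  by (simp add: circ_cong cong_refl)

lemma cancel_left_iff:
  assumes "a \<in> A" "x \<in> A" "y \<in> A"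
  shows "a \<cdot> x \<sim> a \<cdot> y \<longleftrightarrow> x \<sim> y"
proof
  assume "a \<cdot> x \<sim> a \<cdot> y"
  then have "\<^bold>- a \<cdot> (a \<cdot> x) \<sim> \<^bold>- a \<cdot> (a \<cdot> y)"
    using assms by (simp add: add_cong_left)
  then show "x \<sim> y"
    using assms by (simp flip: add.m_assoc)
qed (use assms in \<open>simp add: add_cong_left\<close>)

lemma cancel_right_iff:
  assumes "a \<in> A" "x \<in> A" "y \<in> A"
  shows "x \<cdot> a \<sim> y \<cdot> a \<longleftrightarrow> x \<sim> y"
proof
  assume "x \<cdot> a \<sim> y \<cdot> a"
  then have "x \<cdot> a \<cdot> \<^bold>- a \<sim> y \<cdot> a \<cdot> \<^bold>- a"
    using assms by (simp add: add_cong_right)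
  then show "x \<sim> y"
    using assms by (simp add: add.m_assoc)
qed (use assms in \<open>simp add: add_cong_right\<close>)

lemma star_cong_one_iff:
  assumes "x \<in> A" "y \<in> A"
  shows "brace_star G H x y \<sim> \<one>\<^bsub>G\<^esub> \<longleftrightarrow> x \<odot> y \<sim> x \<cdot> y"
proof -
  have "x \<cdot> (brace_star G H x y \<cdot> y) = x \<odot> y"
    using assms unfolding brace_star_def brace_lambda_def
    by (simp add: add.m_assoc) (simp flip: add.m_assoc)
  then show ?thesis
    using cancel_left_iff[of x "brace_star G H x y \<cdot> y" "\<one>\<^bsub>G\<^esub> \<cdot> y"]
      cancel_right_iff[of y "brace_star G H x y" "\<one>\<^bsub>G\<^esub>"] assms
    by (simp add: brace_star_def brace_lambda_def)
qed

lemma commutator_cong_one_iff: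
  assumes "x \<in> A" "y \<in> A"
  shows "add_commutator G x y \<sim> \<one>\<^bsub>G\<^esub> \<longleftrightarrow> x \<cdot> y \<sim> y \<cdot> x"
proof -
  have "add_commutator G x y \<cdot> (y \<cdot> x) = x \<cdot> y"
    using assms unfolding add_commutator_def
    by (metis add.inv_closed add.inv_solve_right add.m_assoc add.m_closed)
  then show ?thesis
    using cancel_right_iff[of "y \<cdot> x" "add_commutator G x y" "\<one>\<^bsub>G\<^esub>"] assms
    by (simp add: add_commutator_def)
qed

section \<open>The annihilator modulo a congruence\<close>

definition annihilator :: "'a set" where
  "annihilator = {z \<in> A. \<forall>a \<in> A. a \<cdot> z \<sim> z \<cdot> a \<and> a \<odot> z \<sim> a \<cdot> z \<and> z \<odot> a \<sim> z \<cdot> a}"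

text \<open>Membership as it occurs in the upper central series; the defining form with congruences is the
  one that suits calculations.\<close>

lemma annihilator_iff_symbol_op:
  assumes "z \<in> A"
  shows "z \<in> annihilator \<longleftrightarrow> (\<forall>a \<in> A. \<forall>e. symbol_op G H e a z \<sim> \<one>\<^bsub>G\<^esub>)"
proof -
  have "(\<forall>e. symbol_op G H e a z \<sim> \<one>\<^bsub>G\<^esub>) \<longleftrightarrow>
      a \<cdot> z \<sim> z \<cdot> a \<and> a \<odot> z \<sim> a \<cdot> z \<and> z \<odot> a \<sim> z \<cdot> a" (is "?L \<longleftrightarrow> ?R") if "a \<in> A" for a
  proof
    assume ?L
    then show ?R
      using \<open>?L\<close>[rule_format, of Comm] \<open>?L\<close>[rule_format, of Star] \<open>?L\<close>[rule_format, of StarBar]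
        assms that by (simp add: star_cong_one_iff commutator_cong_one_iff)
  next
    assume ?R
    then have "symbol_op G H e a z \<sim> \<one>\<^bsub>G\<^esub>" for e
      using assms that
      by (cases e) (auto simp: star_cong_one_iff commutator_cong_one_iff intro: cong_sym)
    then show ?L ..
  qed
  then show ?thesis
    using assms by (auto simp: annihilator_def)
qed

lemma annihilator_carrier: "z \<in> annihilator \<Longrightarrow> z \<in> A"
  by (simp add: annihilator_def)

lemma annihilatorD:
  assumes "z \<in> annihilator" "a \<in> A"
  shows "a \<cdot> z \<sim> z \<cdot> a" "a \<odot> z \<sim> z \<cdot> a" "z \<odot> a \<sim> z \<cdot> a"
  using assms by (auto simp: annihilator_def intro: cong_trans)

lemma annihilatorI:
  assumes "z \<in> A" "\<And>a. a \<in> A \<Longrightarrow> a \<cdot> z \<sim> z \<cdot> a"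
    "\<And>a. a \<in> A \<Longrightarrow> a \<odot> z \<sim> z \<cdot> a" "\<And>a. a \<in> A \<Longrightarrow> z \<odot> a \<sim> z \<cdot> a"
  shows "z \<in> annihilator"
  using assms cong_trans[OF assms(3) cong_sym[OF assms(2)]] by (simp add: annihilator_def)

lemma one_annihilator: "\<one>\<^bsub>G\<^esub> \<in> annihilator"
  by (simp add: annihilator_def cong_refl)

lemma annihilator_cong:
  assumes z: "z \<in> annihilator" and "z \<sim> w"
  shows "w \<in> annihilator"
proof (rule annihilatorI)
  have zw: "z \<in> A" "w \<in> A" "w \<sim> z"
    using assms in_carrier cong_sym by auto
  show "w \<in> A" by fact
  fix a assume a: "a \<in> A"
  have right: "z \<cdot> a \<sim> w \<cdot> a"
    by (intro add_cong_right a \<open>z \<sim> w\<close>)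
  show "a \<cdot> w \<sim> w \<cdot> a"
    using add_cong_left[OF \<open>w \<sim> z\<close> a] annihilatorD(1)[OF z a] right by (meson cong_trans)
  show "a \<odot> w \<sim> w \<cdot> a"
    using circ_cong_left[OF \<open>w \<sim> z\<close> a] annihilatorD(2)[OF z a] right by (meson cong_trans)
  show "w \<odot> a \<sim> w \<cdot> a"
    using circ_cong_right[OF \<open>w \<sim> z\<close> a] annihilatorD(3)[OF z a] right by (meson cong_trans)
qed

text \<open>The brace identity turns \<open>a \<circ> (z \<cdot> w)\<close> into \<open>(a \<circ> z) \<cdot> a\<^sup>-\<^sup>1 \<cdot> (a \<circ> w)\<close>, in which a factor
  from the annihilator can be split off.\<close>

lemma circ_add_annihilator:
  assumes "z \<in> annihilator" "w \<in> A" "a \<in> A"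
  shows "a \<odot> (z \<cdot> w) \<sim> z \<cdot> (a \<odot> w)"
proof -
  have zA: "z \<in> A" using assms(1) by (rule annihilator_carrier)
  have "a \<odot> (z \<cdot> w) = (a \<odot> z) \<cdot> \<^bold>- a \<cdot> (a \<odot> w)"
    using assms zA by (simp add: brace_compat)
  also have "\<dots> \<sim> (z \<cdot> a) \<cdot> \<^bold>- a \<cdot> (a \<odot> w)"
    using assms by (intro add_cong_right annihilatorD) simp_all
  also have "\<dots> = z \<cdot> (a \<odot> w)"
    using assms zA by (simp add: add.m_assoc)
  finally show ?thesis .
qed

lemma add_annihilator:
  assumes z: "z \<in> annihilator" and w: "w \<in> annihilator"
  shows "z \<cdot> w \<in> annihilator"
proof (rule annihilatorI)
  have A: "z \<in> A" "w \<in> A" using assms annihilator_carrier by auto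
  then show "z \<cdot> w \<in> A" by simp
  fix a assume a: "a \<in> A"
  have "a \<cdot> (z \<cdot> w) = (a \<cdot> z) \<cdot> w"
    using A a by (simp add: add.m_assoc)
  also have "\<dots> \<sim> (z \<cdot> a) \<cdot> w"
    using A a z by (intro add_cong_right annihilatorD)
  also have "\<dots> = z \<cdot> (a \<cdot> w)"
    using A a by (simp add: add.m_assoc)
  also have "\<dots> \<sim> z \<cdot> (w \<cdot> a)"
    using A a w by (intro add_cong_left annihilatorD)
  also have "\<dots> = z \<cdot> w \<cdot> a"
    using A a by (simp add: add.m_assoc)
  finally show "a \<cdot> (z \<cdot> w) \<sim> z \<cdot> w \<cdot> a" .
  have "a \<odot> (z \<cdot> w) \<sim> z \<cdot> (a \<odot> w)"
    using A a z by (intro circ_add_annihilator)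
  also have "\<dots> \<sim> z \<cdot> (w \<cdot> a)"
    using A a w by (intro add_cong_left annihilatorD)
  also have "\<dots> = z \<cdot> w \<cdot> a"
    using A a by (simp add: add.m_assoc)
  finally show "a \<odot> (z \<cdot> w) \<sim> z \<cdot> w \<cdot> a" .
  have "(z \<cdot> w) \<odot> a \<sim> (z \<odot> w) \<odot> a"
    using A a z by (intro circ_cong_right cong_sym[OF annihilatorD(3)])
  also have "\<dots> = z \<odot> (w \<odot> a)"
    using A a by (simp add: circ_assoc)
  also have "\<dots> \<sim> z \<odot> (w \<cdot> a)"
    using A a w by (intro circ_cong_left annihilatorD)
  also have "\<dots> \<sim> z \<cdot> (w \<cdot> a)"
    using A a z by (intro annihilatorD) simp_all
  also have "\<dots> = z \<cdot> w \<cdot> a"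
    using A a by (simp add: add.m_assoc)
  finally show "(z \<cdot> w) \<odot> a \<sim> z \<cdot> w \<cdot> a" .
qed

text \<open>Each of the three conditions for the inverse of \<open>z\<close> is obtained by cancelling \<open>z\<close> on the left.\<close>

lemma inv_annihilator:
  assumes z: "z \<in> annihilator"
  shows "\<^bold>- z \<in> annihilator"
proof (rule annihilatorI)
  have A: "z \<in> A" using z by (rule annihilator_carrier)
  then show "\<^bold>- z \<in> A" by simp
  fix a assume a: "a \<in> A"
  have cancel: "x \<sim> \<^bold>- z \<cdot> a" if "z \<cdot> x \<sim> a" "x \<in> A" for x
  proof -
    have "z \<cdot> (\<^bold>- z \<cdot> a) = a"
      using A a by (simp flip: add.m_assoc)
    then show ?thesis
      using cancel_left_iff[of z x "\<^bold>- z \<cdot> a"] A a that by simp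
  qed
  show "a \<cdot> \<^bold>- z \<sim> \<^bold>- z \<cdot> a"
  proof (rule cancel)
    have "z \<cdot> (a \<cdot> \<^bold>- z) = (z \<cdot> a) \<cdot> \<^bold>- z"
      using A a by (simp add: add.m_assoc)
    also have "\<dots> \<sim> (a \<cdot> z) \<cdot> \<^bold>- z"
      using A a z by (intro add_cong_right cong_sym[OF annihilatorD(1)]) simp_all
    also have "\<dots> = a"
      using A a by (simp add: add.m_assoc)
    finally show "z \<cdot> (a \<cdot> \<^bold>- z) \<sim> a" .
  qed (use A a in simp)
  show "a \<odot> \<^bold>- z \<sim> \<^bold>- z \<cdot> a"
  proof (rule cancel)
    have "z \<cdot> (a \<odot> \<^bold>- z) \<sim> a \<odot> (z \<cdot> \<^bold>- z)"
      using A a z by (intro cong_sym[OF circ_add_annihilator]) simp_all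
    also have "\<dots> = a"
      using A a by simp
    finally show "z \<cdot> (a \<odot> \<^bold>- z) \<sim> a" .
  qed (use A a in simp)
  show "\<^bold>- z \<odot> a \<sim> \<^bold>- z \<cdot> a"
  proof (rule cancel)
    have "z \<cdot> (\<^bold>- z \<odot> a) \<sim> z \<odot> (\<^bold>- z \<odot> a)"
      using A a z by (intro cong_sym[OF annihilatorD(3)]) simp_all
    also have "\<dots> = (z \<odot> \<^bold>- z) \<odot> a"
      using A a by (simp add: circ_assoc)
    also have "\<dots> \<sim> (z \<cdot> \<^bold>- z) \<odot> a"
      using A a z by (intro circ_cong_right annihilatorD) simp_all
    also have "\<dots> = a"
      using A a by simp
    finally show "z \<cdot> (\<^bold>- z \<odot> a) \<sim> a" .
  qed (use A a in simp)
qed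

text \<open>This is congruence modulo the annihilator of the quotient by \<open>\<sim>\<close>, pulled back to \<open>A\<close>.\<close>

definition annihilator_rel :: "'a \<Rightarrow> 'a \<Rightarrow> bool" where
  "annihilator_rel x y \<longleftrightarrow> y \<in> A \<and> (\<exists>z \<in> annihilator. x \<sim> z \<cdot> y)"

lemma annihilator_rel_one_iff: "annihilator_rel x \<one>\<^bsub>G\<^esub> \<longleftrightarrow> x \<in> annihilator"
proof
  assume "annihilator_rel x \<one>\<^bsub>G\<^esub>"
  then obtain z where "z \<in> annihilator" "x \<sim> z"
    by (auto simp: annihilator_rel_def annihilator_carrier)
  then show "x \<in> annihilator"
    using annihilator_cong cong_sym by blast
next
  assume "x \<in> annihilator"
  then show "annihilator_rel x \<one>\<^bsub>G\<^esub>"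
    unfolding annihilator_rel_def using annihilator_carrier cong_refl
    by (intro conjI bexI[of _ x]) simp_all
qed

text \<open>Compatibility holds because factors from the annihilator can be moved past anything and may be
  multiplied by either operation; it makes the next step of the upper central series again the class
  of \<open>1\<close> of a congruence, so that the construction can be iterated.\<close>

lemma brace_congruence_annihilator_rel: "brace_congruence G H annihilator_rel"
proof unfold_locales
  fix x y assume "annihilator_rel x y"
  then show "x \<in> A \<and> y \<in> A"
    using in_carrier by (auto simp: annihilator_rel_def)
next
  fix x assume "x \<in> A"
  then show "annihilator_rel x x"
    unfolding annihilator_rel_def using cong_refl one_annihilator
    by (intro conjI bexI[of _ "\<one>\<^bsub>G\<^esub>"]) simp_all
next
  fix x y assume "annihilator_rel x y"
  then obtain z where z: "z \<in> annihilator" "x \<sim> z \<cdot> y" and y: "y \<in> A"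
    by (auto simp: annihilator_rel_def)
  then have A: "z \<in> A" "x \<in> A"
    using annihilator_carrier in_carrier by auto
  have "y = \<^bold>- z \<cdot> (z \<cdot> y)"
    using A y by (simp flip: add.m_assoc)
  also have "\<dots> \<sim> \<^bold>- z \<cdot> x"
    using A z by (intro add_cong_left cong_sym[OF z(2)]) simp
  finally show "annihilator_rel y x"
    using A z inv_annihilator by (auto simp: annihilator_rel_def)
next
  fix x y w assume "annihilator_rel x y" "annihilator_rel y w"
  then obtain z z' where z: "z \<in> annihilator" "x \<sim> z \<cdot> y" and y: "y \<in> A"
    and z': "z' \<in> annihilator" "y \<sim> z' \<cdot> w" and w: "w \<in> A"
    by (auto simp: annihilator_rel_def)
  then have A: "z \<in> A" "z' \<in> A"
    using annihilator_carrier by auto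
  note \<open>x \<sim> z \<cdot> y\<close>
  also have "z \<cdot> y \<sim> z \<cdot> (z' \<cdot> w)"
    using A z' by (intro add_cong_left)
  also have "\<dots> = z \<cdot> z' \<cdot> w"
    using A w by (simp add: add.m_assoc)
  finally show "annihilator_rel x w"
    using w z z' add_annihilator by (auto simp: annihilator_rel_def)
next
  fix x y x' y' assume "annihilator_rel x y" "annihilator_rel x' y'"
  then obtain z z' where z: "z \<in> annihilator" "x \<sim> z \<cdot> y" and y: "y \<in> A"
    and z': "z' \<in> annihilator" "x' \<sim> z' \<cdot> y'" and y': "y' \<in> A"
    by (auto simp: annihilator_rel_def)
  then have A: "z \<in> A" "z' \<in> A"
    using annihilator_carrier by auto
  note cl = A y y'
  have zz': "z \<cdot> z' \<in> annihilator"
    using z z' add_annihilator by simp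
  have "x \<cdot> x' \<sim> (z \<cdot> y) \<cdot> (z' \<cdot> y')"
    using z z' by (intro add_cong)
  also have "\<dots> = z \<cdot> ((y \<cdot> z') \<cdot> y')"
    using cl by (simp add: add.m_assoc)
  also have "\<dots> \<sim> z \<cdot> ((z' \<cdot> y) \<cdot> y')"
    using cl z' by (intro add_cong_left add_cong_right annihilatorD)
  also have "\<dots> = (z \<cdot> z') \<cdot> (y \<cdot> y')"
    using cl by (simp add: add.m_assoc)
  finally show "annihilator_rel (x \<cdot> x') (y \<cdot> y')"
    using cl zz' by (auto simp: annihilator_rel_def)
  have "x \<odot> x' \<sim> (z \<cdot> y) \<odot> (z' \<cdot> y')"
    using z z' by (intro circ_cong)
  also have "\<dots> \<sim> (z \<odot> y) \<odot> (z' \<cdot> y')"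
    using cl z by (intro circ_cong_right cong_sym[OF annihilatorD(3)]) simp_all
  also have "\<dots> = z \<odot> (y \<odot> (z' \<cdot> y'))"
    using cl by (simp add: circ_assoc)
  also have "\<dots> \<sim> z \<cdot> (y \<odot> (z' \<cdot> y'))"
    using cl z by (intro annihilatorD) simp_all
  also have "\<dots> \<sim> z \<cdot> (z' \<cdot> (y \<odot> y'))"
    using cl z' by (intro add_cong_left circ_add_annihilator)
  also have "\<dots> = (z \<cdot> z') \<cdot> (y \<odot> y')"
    using cl by (simp add: add.m_assoc)
  finally show "annihilator_rel (x \<odot> x') (y \<odot> y')"
    using cl zz' by (auto simp: annihilator_rel_def)
qed

lemma class_one_subgroup: "subgroup {z. z \<sim> \<one>\<^bsub>G\<^esub>} G"
proof (rule add.subgroupI)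
  show "{z. z \<sim> \<one>\<^bsub>G\<^esub>} \<subseteq> A"
    using in_carrier by auto
  show "{z. z \<sim> \<one>\<^bsub>G\<^esub>} \<noteq> {}"
    using cong_refl by blast
next
  fix a assume a: "a \<in> {z. z \<sim> \<one>\<^bsub>G\<^esub>}"
  then have "a \<in> A" using in_carrier by simp
  then have "\<^bold>- a \<cdot> \<one>\<^bsub>G\<^esub> \<sim> \<^bold>- a \<cdot> a"
    using a by (intro add_cong_left[OF cong_sym]) simp_all
  then show "\<^bold>- a \<in> {z. z \<sim> \<one>\<^bsub>G\<^esub>}"
    using \<open>a \<in> A\<close> by simp
next
  fix a b assume "a \<in> {z. z \<sim> \<one>\<^bsub>G\<^esub>}" "b \<in> {z. z \<sim> \<one>\<^bsub>G\<^esub>}"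
  then show "a \<cdot> b \<in> {z. z \<sim> \<one>\<^bsub>G\<^esub>}"
    using add_cong[of a "\<one>\<^bsub>G\<^esub>" b "\<one>\<^bsub>G\<^esub>"] by simp
qed

end

section \<open>The upper central series\<close>

context skew_brace
begin

primrec upper_central_rel :: "nat \<Rightarrow> 'a \<Rightarrow> 'a \<Rightarrow> bool" where
  "upper_central_rel 0 = (\<lambda>x y. x \<in> A \<and> x = y)"
| "upper_central_rel (Suc k) = brace_congruence.annihilator_rel G H (upper_central_rel k)"

definition upper_central :: "nat \<Rightarrow> 'a set" where
  "upper_central k = {z. upper_central_rel k z \<one>\<^bsub>G\<^esub>}"

lemma brace_congruence_upper_central_rel: "brace_congruence G H (upper_central_rel k)"
proof (induction k)
  case 0
  show ?case by unfold_locales auto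
next
  case (Suc k)
  then show ?case by (simp add: brace_congruence.brace_congruence_annihilator_rel)
qed

lemma upper_central_0: "upper_central 0 = {\<one>\<^bsub>G\<^esub>}"
  by (auto simp: upper_central_def)

lemma upper_central_subgroup: "subgroup (upper_central k) G"
  unfolding upper_central_def
  using brace_congruence_upper_central_rel by (rule brace_congruence.class_one_subgroup)

lemma upper_central_carrier: "z \<in> upper_central k \<Longrightarrow> z \<in> A"
  using subgroup.mem_carrier upper_central_subgroup by fast

lemma upper_central_Suc_iff:
  assumes "z \<in> A"
  shows "z \<in> upper_central (Suc k) \<longleftrightarrow>
    (\<forall>a \<in> A. \<forall>e. symbol_op G H e a z \<in> upper_central k)"
proof -
  interpret brace_congruence G H "upper_central_rel k"
    by (rule brace_congruence_upper_central_rel)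
  show ?thesis
    using assms by (simp add: upper_central_def annihilator_rel_one_iff annihilator_iff_symbol_op)
qed

section \<open>Words and the lower central series\<close>

definition word_values :: "nat \<Rightarrow> 'a set" where
  "word_values t =
     {word_value G H m as | m as. length m \<ge> t \<and> length as = length m + 1 \<and> set as \<subseteq> A}"

lemma word_value_closed:
  "\<lbrakk>length as = length m + 1; set as \<subseteq> A\<rbrakk> \<Longrightarrow> word_value G H m as \<in> A"
proof (induction m arbitrary: as)
  case Nil
  then show ?case by (cases as) auto
next
  case (Cons e m)
  then show ?case by (cases as) auto
qed

lemma word_values_carrier: "word_values t \<subseteq> A"
  by (auto simp: word_values_def intro: word_value_closed)

lemma word_values_0: "word_values 0 = A"
proof
  show "A \<subseteq> word_values 0"
  proof
    fix a assume "a \<in> A"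
    then have "word_value G H [] [a] \<in> word_values 0"
      unfolding word_values_def by fastforce
    then show "a \<in> word_values 0" by simp
  qed
qed (rule word_values_carrier)

lemma symbol_op_word_values:
  assumes "a \<in> A" "u \<in> word_values t"
  shows "symbol_op G H e a u \<in> word_values (Suc t)"
proof -
  obtain m as where "u = word_value G H m as" "length m \<ge> t" "length as = length m + 1"
    "set as \<subseteq> A"
    using assms(2) by (auto simp: word_values_def)
  then have "symbol_op G H e a u = word_value G H (e # m) (a # as)" "length (e # m) \<ge> Suc t"
    "length (a # as) = length (e # m) + 1" "set (a # as) \<subseteq> A"
    using assms(1) by auto
  then show ?thesis
    unfolding word_values_def by blast
qed

lemma word_subgroup_trivial_iff:
  "brace_word_subgroup G H t = {\<one>\<^bsub>G\<^esub>} \<longleftrightarrow> word_values t \<subseteq> {\<one>\<^bsub>G\<^esub>}"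
proof -
  have "brace_word_subgroup G H t = generate G (word_values t)"
    by (simp add: brace_word_subgroup_def word_values_def)
  moreover have "generate G (word_values t) \<subseteq> {\<one>\<^bsub>G\<^esub>}" if "word_values t \<subseteq> {\<one>\<^bsub>G\<^esub>}"
    using add.generate_subgroup_incl[OF that add.triv_subgroup] .
  moreover have "word_values t \<subseteq> generate G (word_values t)" "\<one>\<^bsub>G\<^esub> \<in> generate G (word_values t)"
    by (auto intro: generate.incl generate.one)
  ultimately show ?thesis by auto
qed

text \<open>The upper central series absorbs words of ever smaller degree, because one more
  symbol in front of a word raises its degree by one.\<close>

lemma word_values_subset_upper_central:
  assumes "word_values (n + k) \<subseteq> {\<one>\<^bsub>G\<^esub>}"
  shows "word_values n \<subseteq> upper_central k"
  using assms
proof (induction k arbitrary: n)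
  case 0
  then show ?case by (simp add: upper_central_0)
next
  case (Suc k)
  then have IH: "word_values (Suc n) \<subseteq> upper_central k" by simp
  show ?case
  proof
    fix z assume "z \<in> word_values n"
    then have "z \<in> A" "\<forall>a \<in> A. \<forall>e. symbol_op G H e a z \<in> upper_central k"
      using symbol_op_word_values word_values_carrier IH by blast+
    then show "z \<in> upper_central (Suc k)"
      by (simp add: upper_central_Suc_iff)
  qed
qed

corollary carrier_subset_upper_central:
  assumes "word_values t \<subseteq> {\<one>\<^bsub>G\<^esub>}"
  shows "A \<subseteq> upper_central t"
  using word_values_subset_upper_central[of 0 t] assms by (simp add: word_values_0)

lemma Gamma_Suc_symbol_op:
  "brace_Gamma G H (Suc (Suc n)) =
     generate G (\<Union>a \<in> A. \<Union>u \<in> brace_Gamma G H (Suc n).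
       (\<lambda>e. symbol_op G H e a u) ` {Star, StarBar, Comm})"
  by simp

text \<open>As \<open>upper_central k\<close> is a subgroup, it suffices to place the generators of the lower central
  series, and these are symbols applied to elements of the preceding term.\<close>

lemma Gamma_subset_upper_central:
  assumes "A \<subseteq> upper_central (n + k)"
  shows "brace_Gamma G H (Suc n) \<subseteq> upper_central k"
  using assms
proof (induction n arbitrary: k)
  case 0
  then show ?case by simp
next
  case (Suc n)
  then have IH: "brace_Gamma G H (Suc n) \<subseteq> upper_central (Suc k)" by simp
  show ?case
    unfolding Gamma_Suc_symbol_op
  proof (rule add.generate_subgroup_incl[OF _ upper_central_subgroup])
    show "(\<Union>a \<in> A. \<Union>u \<in> brace_Gamma G H (Suc n).
        (\<lambda>e. symbol_op G H e a u) ` {Star, StarBar, Comm}) \<subseteq> upper_central k"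
      using IH upper_central_carrier upper_central_Suc_iff by blast
  qed
qed

lemma Gamma_subgroup: "subgroup (brace_Gamma G H (Suc n)) G"
proof (induction n)
  case 0
  show ?case using add.subgroup_self by simp
next
  case (Suc n)
  have "(\<Union>a \<in> A. \<Union>u \<in> brace_Gamma G H (Suc n).
      (\<lambda>e. symbol_op G H e a u) ` {Star, StarBar, Comm}) \<subseteq> A"
    using subgroup.mem_carrier[OF Suc] symbol_op_closed by blast
  then show ?case
    unfolding Gamma_Suc_symbol_op by (rule add.generate_is_subgroup)
qed

lemma symbol_op_Gamma:
  assumes "a \<in> A" "u \<in> brace_Gamma G H (Suc n)"
  shows "symbol_op G H e a u \<in> brace_Gamma G H (Suc (Suc n))"
proof -
  have gen: "symbol_op G H f a u \<in> brace_Gamma G H (Suc (Suc n))" if "f \<in> {Star, StarBar, Comm}" for f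
    unfolding Gamma_Suc_symbol_op using assms that by (intro generate.incl) blast
  show ?thesis
  proof (cases "e = CommBar")
    case True
    have uA: "u \<in> A" using subgroup.mem_carrier[OF Gamma_subgroup assms(2)] .
    \<comment> \<open>The remaining symbol yields the inverse of a generator.\<close>
    have "add_commutator G u a = \<^bold>- (add_commutator G a u)"
      using assms(1) uA by (simp add: add_commutator_def add.inv_mult_group add.m_assoc)
    then show ?thesis
      using True gen[of Comm] subgroup.m_inv_closed[OF Gamma_subgroup] by fastforce
  next
    case False
    then show ?thesis by (cases e) (use gen in blast)+
  qed
qed

lemma Gamma_antimono:
  assumes "m \<le> n"
  shows "brace_Gamma G H (Suc n) \<subseteq> brace_Gamma G H (Suc m)"
proof -
  have "brace_Gamma G H (Suc (Suc k)) \<subseteq> brace_Gamma G H (Suc k)" for k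
  proof (induction k)
    case 0
    show ?case using subgroup.subset[OF Gamma_subgroup[of "Suc 0"]] by simp
  next
    case (Suc k)
    then show ?case
      unfolding Gamma_Suc_symbol_op[of "Suc k"] Gamma_Suc_symbol_op[of k]
      by (intro add.mono_generate) blast
  qed
  then show ?thesis
    using lift_Suc_antimono_le[of "\<lambda>k. brace_Gamma G H (Suc k)"] assms by blast
qed

lemma word_value_Gamma:
  "\<lbrakk>length as = length m + 1; set as \<subseteq> A\<rbrakk> \<Longrightarrow> word_value G H m as \<in> brace_Gamma G H (Suc (length m))"
proof (induction m arbitrary: as)
  case Nil
  then show ?case by (cases as) auto
next
  case (Cons e m)
  then obtain a bs where as: "as = a # bs" by (cases as) auto
  then have "word_value G H m bs \<in> brace_Gamma G H (Suc (length m))"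
    using Cons by simp
  then show ?case
    using symbol_op_Gamma[of a] Cons.prems as by simp
qed

lemma word_values_subset_Gamma: "word_values t \<subseteq> brace_Gamma G H (Suc t)"
  unfolding word_values_def using word_value_Gamma Gamma_antimono by blast

end

theorem theorem4p2:
  fixes G :: "('a, 'm) monoid_scheme" and H :: "('a, 'n) monoid_scheme" and t :: nat
  assumes "skew_brace G H" and "t \<ge> 1"
  shows "brace_word_subgroup G H t = {\<one>\<^bsub>G\<^esub>} \<longleftrightarrow> brace_Gamma G H (t + 1) = {\<one>\<^bsub>G\<^esub>}"
proof -
  interpret skew_brace G H by fact
  show ?thesis
  proof
    assume "brace_word_subgroup G H t = {\<one>\<^bsub>G\<^esub>}"
    then have "carrier G \<subseteq> upper_central t"
      by (simp add: word_subgroup_trivial_iff carrier_subset_upper_central)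
    then have "brace_Gamma G H (t + 1) \<subseteq> {\<one>\<^bsub>G\<^esub>}"
      using Gamma_subset_upper_central[of t 0] by (simp add: upper_central_0)
    then show "brace_Gamma G H (t + 1) = {\<one>\<^bsub>G\<^esub>}"
      using subgroup.one_closed[OF Gamma_subgroup[of t]] by auto
  next
    assume "brace_Gamma G H (t + 1) = {\<one>\<^bsub>G\<^esub>}"
    then show "brace_word_subgroup G H t = {\<one>\<^bsub>G\<^esub>}"
      using word_values_subset_Gamma[of t] by (simp add: word_subgroup_trivial_iff)
  qed
qed

end
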